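(* The algorithmic breadth-first traversal of a nonempty wellordered connected graph $(V,E,<)$ is lexicographically least among all (wellordered) breadth-first traversals of $(V,E)$.
   Context: A wellordered connected graph $(V,E,<)$ is a connected undirected graph $(V,E)$ (possibly infinite) together with a wellordering $<$ of $V$. A wellordered traversal of $(V,E)$ is a wellordering of $V$ all of whose initial segments induce connected subgraphs. Its least neighbor function $p$ takes each vertex other than the minimum to its least neighbor with respect to that wellordering. A breadth-first traversal is a wellordered traversal $\prec$ whose least neighbor function is weakly monotone: $v\preceq w$ implies $p(v)\preceq p(w)$ for all non-minimal $v,w$. Deterministic breadth-first search on $(V,E,<)$: define sets $B_\alpha$ and sequences $Q_\alpha$ (regarded both as sequences and as sets) by transfinite recursion, where $q_\alpha$ denotes the first element of $Q_\alpha\setminus B_\alpha$ whenever that is nonempty. $B_0=\emptyset$ and $Q_0=(v_0)$, where $v_0$ is the $<$-least element of $V$. If $Q_\alpha\setminus B_\alpha\neq\emptyset$, then $B_{\alpha+1}=B_\alpha\cup\{q_\alpha\}$ and $Q_{\alpha+1}$ is obtained from $Q_\alpha$ by appending at the end, in $<$-order, all neighbors of $q_\alpha$ not in $Q_\alpha$; otherwise $B_{\alpha+1}=B_\alpha$ and $Q_{\alpha+1}=Q_\alpha$. At limit $\alpha$, $B_\alpha=\bigcup_{\beta<\alpha}B_\beta$ and $Q_\alpha=\bigcup_{\beta<\alpha}Q_\beta$ (each later sequence end-extends the earlier ones). The closure ordinal $\Gamma$ is the least ordinal with $B_\Gamma=B_{\Gamma+1}$; one has $B_\Gamma=V$, so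 $\alpha\mapsto q_\alpha$ is a bijection $\Gamma\to V$. The algorithmic breadth-first traversal is the wellordering $\prec$ of $V$ with $q_\alpha\prec q_\beta$ iff $\alpha<\beta$; it is a breadth-first traversal. Wellorderings of $V$ are identified with their order-enumerating bijections from an ordinal onto $V$. For distinct wellorderings $f,f'$ of $V$, let $\xi$ be the least ordinal with $f(\xi)\ne f'(\xi)$; $f$ is lexicographically less than $f'$ iff $f(\xi)<f'(\xi)$. *)

theory Defs
  imports Main
begin

unbundle cardinal_syntax

section \<open>Ordinals\<close>

text \<open>
  Ordinals are isomorphism classes of well-orders. The type \<open>'v ordinal\<close> consists of the order
  types of well-orders on subsets of \<open>nat + 'v\<close>, that is, of all ordinals of cardinality at most
  \<open>max \<aleph>\<^sub>0 |'v|\<close>. This type is closed under successor and contains the order type of every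
  well-order on a set of elements of \<open>'v\<close>. It also contains the closure ordinal of the search
  defined below, since the latter is in bijection with a set of elements of \<open>'v\<close>.
\<close>

quotient_type 'v ordinal = "(nat + 'v) rel" / partial: "\<lambda>r s. r =o s"
proof (rule part_equivpI)
  show "\<exists>r :: (nat + 'v) rel. r =o r"
    using card_of_Well_order ordIso_reflexive by blast
  show "symp (\<lambda>(r :: (nat + 'v) rel) s. r =o s)"
    by (auto intro!: sympI ordIso_symmetric)
  show "transp (\<lambda>(r :: (nat + 'v) rel) s. r =o s)"
    by (auto intro!: transpI elim: ordIso_transitive)
qed

instantiation ordinal :: (type) wellorder
begin

lift_definition less_eq_ordinal :: "'v ordinal \<Rightarrow> 'v ordinal \<Rightarrow> bool"
  is "\<lambda>r s. r \<le>o s"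
  by (meson ordIso_ordLeq_trans ordIso_symmetric ordLeq_ordIso_trans)

lift_definition less_ordinal :: "'v ordinal \<Rightarrow> 'v ordinal \<Rightarrow> bool"
  is "\<lambda>r s. r <o s"
  by (meson ordIso_ordLess_trans ordIso_symmetric ordLess_ordIso_trans)

instance
proof
  fix x y z :: "'v ordinal"
  have wo: "Well_order r" if "r =o r" for r :: "(nat + 'v) rel"
    using that by (auto simp: ordIso_def)
  show "(x < y) = (x \<le> y \<and> \<not> y \<le> x)"
    by transfer (use wo not_ordLess_ordLeq ordLess_imp_ordLeq ordLess_or_ordLeq in blast)
  show "x \<le> x"
    by transfer (simp add: ordIso_imp_ordLeq)
  show "x \<le> y \<Longrightarrow> y \<le> z \<Longrightarrow> x \<le> z"
    by transfer (rule ordLeq_transitive)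
  show "x \<le> y \<Longrightarrow> y \<le> x \<Longrightarrow> x = y"
    by transfer (simp add: ordIso_iff_ordLeq)
  show "x \<le> y \<or> y \<le> x"
    by transfer (use wo ordLeq_total in blast)
next
  fix P :: "'v ordinal \<Rightarrow> bool" and a
  assume step: "\<And>x. (\<And>y. y < x \<Longrightarrow> P y) \<Longrightarrow> P x"
  have "{(x :: 'v ordinal, y). x < y} \<subseteq> inv_image ordLess rep_ordinal"
    by (auto simp: less_ordinal.rep_eq)
  then have "wf {(x :: 'v ordinal, y). x < y}"
    by (rule wf_subset[OF wf_inv_image[OF wf_ordLess]])
  then show "P a"
    by (induction a rule: wf_induct_rule) (use step in auto)
qed

end

definition ozero :: "'v ordinal"
  where "ozero = (LEAST \<alpha>. True)"

definition osuc :: "'v ordinal \<Rightarrow> 'v ordinal"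
  where "osuc \<alpha> = (LEAST \<beta>. \<alpha> < \<beta>)"

lemma ordinal_no_top:
  fixes \<alpha> :: "'v ordinal"
  shows "\<exists>\<beta>. \<alpha> < \<beta>"
proof transfer
  fix r :: "(nat + 'v) rel"
  assume "r =o r"
  then have r: "Well_order r"
    by (auto simp: ordIso_def)
  define g :: "nat + 'v \<Rightarrow> nat + 'v" where "g = map_sum Suc id"
  define t :: "nat + 'v" where "t = Inl 0"
  have g: "inj g"
    unfolding g_def by (simp add: sum.inj_map)
  have tg: "t \<noteq> g x" for x
    unfolding t_def g_def by (cases x) auto
  define r1 where "r1 = dir_image r g"
  have r1: "Well_order r1" "r =o r1"
    unfolding r1_def using r g
    by (auto intro!: Well_order_dir_image dir_image_ordIso elim: inj_on_subset)
  have tF: "t \<notin> Field r1"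
    unfolding r1_def using tg by (auto simp: dir_image_Field)
  define s where "s = r1 \<union> insert t (Field r1) \<times> {t}"
  have Fs: "Field s = insert t (Field r1)"
    unfolding s_def Field_def by auto
  have sub: "(a, b) \<in> r1 \<Longrightarrow> a \<in> Field r1 \<and> b \<in> Field r1" for a b
    by (auto simp: Field_def)
  have "s - Id = (r1 - Id) \<union> Field r1 \<times> {t}"
    unfolding s_def using tF sub by auto
  moreover have "wf (r1 - Id)"
    using r1(1) by (simp add: well_order_on_def)
  then have "wf ((r1 - Id) \<union> Field r1 \<times> {t})"
    by (rule wf_Un) (use tF sub in \<open>auto simp: wf_def, metis\<close>)
  ultimately have "wf (s - Id)"
    by simp
  moreover have "Linear_order s"
    using r1(1) tF sub unfolding Fs unfolding s_def
    by (auto simp: well_order_on_def linear_order_on_def partial_order_on_def preorder_on_def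
        refl_on_def total_on_def antisym_def intro!: transI dest: transD)
  ultimately have s: "Well_order s"
    by (simp add: well_order_on_def)
  have "r1 = Restr s (underS s t)"
    using sub tF by (auto simp: s_def underS_def)
  then have "r1 <o s"
    using ordLess_iff_ordIso_Restr[OF s r1(1)] Fs ordIso_reflexive[OF r1(1)] by auto
  then have "r <o s"
    using r1(2) ordIso_ordLess_trans by blast
  then show "\<exists>s\<in>Collect (\<lambda>s :: (nat + 'v) rel. s =o s). r <o s"
    using s ordIso_reflexive by blast
qed

lemma less_osuc: "\<alpha> < osuc \<alpha>"
  unfolding osuc_def using ordinal_no_top by (rule LeastI_ex)

lemma osuc_inject [simp]: "osuc \<alpha> = osuc \<beta> \<longleftrightarrow> \<alpha> = \<beta>"
  by (metis less_osuc linorder_neqE not_less_Least osuc_def)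

section \<open>Wellorderings as enumerations and their lexicographic order\<close>

text \<open>
  Wellorderings are represented as reflexive relations \<open>t\<close> with \<open>well_order_on V t\<close>.
  A function from an ordinal \<open>\<gamma>\<close> to \<open>'v\<close> is a partial function with domain \<open>{..<\<gamma>}\<close>.
\<close>

definition enumerates :: "('v ordinal \<rightharpoonup> 'v) \<Rightarrow> 'v rel \<Rightarrow> bool"
  where "enumerates f t \<longleftrightarrow>
    (\<exists>\<gamma>. dom f = {..<\<gamma>}) \<and> inj_on f (dom f) \<and> ran f = Field t \<and>
    (\<forall>\<xi>\<in>dom f. \<forall>\<eta>\<in>dom f. \<xi> \<le> \<eta> \<longleftrightarrow> (the (f \<xi>), the (f \<eta>)) \<in> t)"

lemma enumerates_unique:
  assumes f: "enumerates f t" and g: "enumerates g t" and t: "Well_order t"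
  shows "f = g"
proof -
  interpret wo_rel t
    using t by (rule wo_rel.intro)
  have antisym: "x = y" if "(x, y) \<in> t" "(y, x) \<in> t" for x y
    using ANTISYM that by (auto dest: antisymD)
  have le: "\<exists>y. k \<xi> = Some y \<and> (y, x) \<in> t"
    if h: "enumerates h t" and k: "enumerates k t" and eq: "\<And>\<eta>. \<eta> < \<xi> \<Longrightarrow> h \<eta> = k \<eta>"
      and x: "h \<xi> = Some x" for h k :: "'a ordinal \<rightharpoonup> 'a" and \<xi> x
  proof -
    have "x \<in> ran k"
      using h k x by (auto simp: enumerates_def intro: ranI)
    then obtain \<zeta> where \<zeta>: "k \<zeta> = Some x"
      by (auto simp: ran_def)
    have "\<not> \<zeta> < \<xi>"
    proof
      assume "\<zeta> < \<xi>"
      then have "h \<zeta> = h \<xi>"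
        using eq \<zeta> x by simp
      moreover have "\<zeta> \<in> dom h" "\<xi> \<in> dom h"
        using \<open>h \<zeta> = h \<xi>\<close> x by auto
      ultimately have "\<zeta> = \<xi>"
        using h unfolding enumerates_def inj_on_def by blast
      then show False
        using \<open>\<zeta> < \<xi>\<close> by simp
    qed
    then have le: "\<xi> \<le> \<zeta>"
      by simp
    have "\<zeta> \<in> dom k"
      using \<zeta> by auto
    moreover have "\<xi> \<in> dom k"
      using k \<open>\<zeta> \<in> dom k\<close> le unfolding enumerates_def
      by (metis lessThan_iff le_less_trans)
    ultimately show ?thesis
      using k le \<zeta> unfolding enumerates_def by (metis domD option.sel)
  qed
  have "f \<xi> = g \<xi>" for \<xi>
  proof (induction \<xi> rule: less_induct)
    case (less \<xi>)
    show ?case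
    proof (cases "f \<xi>")
      case None
      then show ?thesis
        using le[OF g f, of \<xi>] less by (cases "g \<xi>") auto
    next
      case (Some x)
      then obtain y where y: "g \<xi> = Some y" "(y, x) \<in> t"
        using le[OF f g] less by metis
      then obtain z where "f \<xi> = Some z" "(z, y) \<in> t"
        using le[OF g f] less by metis
      then show ?thesis
        using Some y antisym by auto
    qed
  qed
  then show ?thesis ..
qed

lemma enumerates_ex:
  assumes t: "Well_order t"
  shows "\<exists>f. enumerates f t"
proof -
  interpret wo_rel t
    using t by (rule wo_rel.intro)
  define T where "T = dir_image t (Inr :: 'a \<Rightarrow> nat + 'a)"
  define R where "R v = dir_image (Restr t (underS v)) (Inr :: 'a \<Rightarrow> nat + 'a)" for v
  have T: "Well_order T" "t =o T"
    unfolding T_def using t by (auto intro!: Well_order_dir_image dir_image_ordIso)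
  have R: "Well_order (R v)" "Restr t (underS v) =o R v" for v
    unfolding R_def using Well_order_Restr[OF t]
    by (auto intro!: Well_order_dir_image dir_image_ordIso)
  define g where "g v = abs_ordinal (R v)" for v
  have g_le: "g v \<le> g w \<longleftrightarrow> (v, w) \<in> t" if "v \<in> Field t" "w \<in> Field t" for v w
  proof -
    have "g v \<le> g w \<longleftrightarrow> R v \<le>o R w"
      unfolding g_def by (simp add: less_eq_ordinal.abs_eq R ordIso_reflexive)
    also have "\<dots> \<longleftrightarrow> Restr t (underS v) \<le>o Restr t (underS w)"
      using R by (meson ordIso_ordLeq_trans ordIso_symmetric ordLeq_ordIso_trans)
    also have "\<dots> \<longleftrightarrow> underS v \<subseteq> underS w"
      by (rule ofilter_subset_ordLeq[OF t underS_ofilter underS_ofilter, symmetric])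
    also have "\<dots> \<longleftrightarrow> (v, w) \<in> t"
      using that LIN by (metis underS_incl_iff)
    finally show ?thesis .
  qed
  have g_inj: "inj_on g (Field t)"
  proof (rule inj_onI)
    fix v w assume "v \<in> Field t" "w \<in> Field t" "g v = g w"
    then have "(v, w) \<in> t" "(w, v) \<in> t"
      using g_le by (metis order_refl)+
    then show "v = w"
      using ANTISYM by (auto dest: antisymD)
  qed
  have g_img: "g ` Field t = {..<abs_ordinal T}"
  proof (intro set_eqI iffI)
    fix \<xi> assume "\<xi> \<in> g ` Field t"
    then obtain v where v: "v \<in> Field t" "\<xi> = abs_ordinal (R v)"
      by (auto simp: g_def)
    have "Restr t (underS v) <o t"
      using v ordLess_iff_ordIso_Restr[OF t Well_order_Restr[OF t]]
        ordIso_reflexive[OF Well_order_Restr[OF t]] by blast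
    then have "R v <o T"
      using R(2) T(2) by (meson ordIso_ordLess_trans ordIso_symmetric ordLess_ordIso_trans)
    then show "\<xi> \<in> {..<abs_ordinal T}"
      using v by (simp add: less_ordinal.abs_eq R T ordIso_reflexive)
  next
    fix \<xi> assume "\<xi> \<in> {..<abs_ordinal T}"
    then have lt: "\<xi> < abs_ordinal T"
      by simp
    define S where "S = rep_ordinal \<xi>"
    have S: "S =o S" "\<xi> = abs_ordinal S"
      unfolding S_def
      by (simp_all add: Quotient_rep_reflp[OF Quotient_ordinal]
          Quotient_abs_rep[OF Quotient_ordinal])
    then have "S <o T"
      using lt by (simp add: less_ordinal.abs_eq T ordIso_reflexive)
    then have "S <o t"
      using T(2) ordIso_symmetric ordLess_ordIso_trans by blast
    moreover have "Well_order S"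
      using S(1) by (auto simp: ordIso_def)
    ultimately obtain v where v: "v \<in> Field t" "S =o Restr t (underS v)"
      using ordLess_iff_ordIso_Restr[OF t] by blast
    then have "S =o R v"
      using R(2) ordIso_transitive by blast
    then have "\<xi> = g v"
      unfolding g_def S(2)
      using Quotient_rel_abs[OF Quotient_ordinal] by blast
    then show "\<xi> \<in> g ` Field t"
      using v by blast
  qed
  define f where "f \<xi> = (if \<xi> \<in> g ` Field t then Some (the_inv_into (Field t) g \<xi>) else None)" for \<xi>
  have f_g: "f (g v) = Some v" if "v \<in> Field t" for v
    using that g_inj by (simp add: f_def the_inv_into_f_f)
  have dom: "dom f = g ` Field t"
    by (auto simp: f_def dom_def)
  have "enumerates f t"
    unfolding enumerates_def
  proof (intro conjI)
    show "\<exists>\<gamma>. dom f = {..<\<gamma>}"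
      using dom g_img by metis
    show "inj_on f (dom f)"
      unfolding dom by (rule inj_onI) (auto simp: f_g)
    show "ran f = Field t"
    proof (intro set_eqI iffI)
      fix v assume "v \<in> ran f"
      then obtain \<xi> where "f \<xi> = Some v"
        by (auto simp: ran_def)
      moreover from this obtain w where "w \<in> Field t" "\<xi> = g w"
        using dom by blast
      ultimately show "v \<in> Field t"
        using f_g by auto
    qed (auto intro: ranI f_g)
    show "\<forall>\<xi>\<in>dom f. \<forall>\<eta>\<in>dom f. \<xi> \<le> \<eta> \<longleftrightarrow> (the (f \<xi>), the (f \<eta>)) \<in> t"
      unfolding dom by (auto simp: f_g g_le)
  qed
  then show ?thesis by blast
qed

definition enumeration :: "'v rel \<Rightarrow> ('v ordinal \<rightharpoonup> 'v)"
  where "enumeration t = (THE f. enumerates f t)"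

lemma enumerates_enumeration: "Well_order t \<Longrightarrow> enumerates (enumeration t) t"
  unfolding enumeration_def
  using enumerates_ex enumerates_unique by (metis theI)

definition lex_less :: "'v rel \<Rightarrow> 'v rel \<Rightarrow> 'v rel \<Rightarrow> bool"
  where "lex_less r t t' \<longleftrightarrow>
    (let f = enumeration t; f' = enumeration t'; \<xi> = (LEAST \<xi>. f \<xi> \<noteq> f' \<xi>)
     in f \<noteq> f' \<and> (\<exists>x y. f \<xi> = Some x \<and> f' \<xi> = Some y \<and> x \<noteq> y \<and> (x, y) \<in> r))"


section \<open>Wellordered connected graphs and breadth-first traversals\<close>

text \<open>
  An undirected graph on \<open>V\<close> is a symmetric irreflexive relation \<open>E\<close> on \<open>V\<close>. The subgraph
  induced by \<open>S\<close> has edge relation \<open>Restr E S\<close>; the empty graph counts as connected.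
\<close>

definition undirected_graph :: "'v set \<Rightarrow> 'v rel \<Rightarrow> bool"
  where "undirected_graph V E \<longleftrightarrow> E \<subseteq> V \<times> V \<and> sym E \<and> irrefl E"

definition induces_connected :: "'v rel \<Rightarrow> 'v set \<Rightarrow> bool"
  where "induces_connected E S \<longleftrightarrow> (\<forall>u\<in>S. \<forall>v\<in>S. (u, v) \<in> (Restr E S)\<^sup>*)"

definition wellordered_connected_graph :: "'v set \<Rightarrow> 'v rel \<Rightarrow> 'v rel \<Rightarrow> bool"
  where "wellordered_connected_graph V E r \<longleftrightarrow>
    undirected_graph V E \<and> induces_connected E V \<and> well_order_on V r"

text \<open>The sets \<open>S\<close> with \<open>ofilter t S\<close> are the initial segments of \<open>t\<close>.\<close>

definition wellordered_traversal :: "'v set \<Rightarrow> 'v rel \<Rightarrow> 'v rel \<Rightarrow> bool"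
  where "wellordered_traversal V E t \<longleftrightarrow>
    well_order_on V t \<and> (\<forall>S. ofilter t S \<longrightarrow> induces_connected E S)"

definition least_neighbor :: "'v rel \<Rightarrow> 'v rel \<Rightarrow> 'v \<Rightarrow> 'v"
  where "least_neighbor E t v = wo_rel.minim t (E `` {v})"

definition breadth_first_traversal :: "'v set \<Rightarrow> 'v rel \<Rightarrow> 'v rel \<Rightarrow> bool"
  where "breadth_first_traversal V E t \<longleftrightarrow>
    wellordered_traversal V E t \<and>
    (\<forall>v\<in>V - {wo_rel.minim t V}. \<forall>w\<in>V - {wo_rel.minim t V}.
      (v, w) \<in> t \<longrightarrow> (least_neighbor E t v, least_neighbor E t w) \<in> t)"


section \<open>Deterministic breadth-first search\<close>

text \<open>
  The sequences \<open>Q\<^sub>\<alpha>\<close> have no repetitions. Such a sequence is represented by the reflexive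
  well-order \<open>Q\<close> on the set of its terms in which they are listed; that set is \<open>Field Q\<close>, and the
  limit of end-extensions is the union of the relations. \<open>append_in_order r Q N\<close> appends the
  elements of a set \<open>N\<close> disjoint from \<open>Field Q\<close>, listed in the order \<open>r\<close>.
\<close>

definition append_in_order :: "'v rel \<Rightarrow> 'v rel \<Rightarrow> 'v set \<Rightarrow> 'v rel"
  where "append_in_order r Q N = Q \<union> Field Q \<times> N \<union> Restr r N"

definition first_unvisited :: "'v set \<times> 'v rel \<Rightarrow> 'v"
  where "first_unvisited = (\<lambda>(B, Q). wo_rel.minim Q (Field Q - B))"

definition bfs_step :: "'v rel \<Rightarrow> 'v rel \<Rightarrow> 'v set \<times> 'v rel \<Rightarrow> 'v set \<times> 'v rel"
  where "bfs_step E r = (\<lambda>(B, Q).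
    if Field Q - B \<noteq> {} then
      let q = first_unvisited (B, Q)
      in (B \<union> {q}, append_in_order r Q (E `` {q} - Field Q))
    else (B, Q))"

function bfs :: "'v rel \<Rightarrow> 'v rel \<Rightarrow> 'v ordinal \<Rightarrow> 'v set \<times> 'v rel"
  where "bfs E r \<alpha> =
    (if \<alpha> = ozero then
       (let v\<^sub>0 = wo_rel.minim r (Field r) in ({}, {(v\<^sub>0, v\<^sub>0)}))
     else if \<exists>\<beta>. \<alpha> = osuc \<beta> then
       bfs_step E r (bfs E r (THE \<beta>. \<alpha> = osuc \<beta>))
     else
       (\<Union>\<beta>\<in>{..<\<alpha>}. fst (bfs E r \<beta>), \<Union>\<beta>\<in>{..<\<alpha>}. snd (bfs E r \<beta>)))"
  by pat_completeness auto
termination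
  by (relation "inv_image {(\<alpha>, \<beta>). \<alpha> < \<beta>} (\<lambda>(E, r, \<alpha>). \<alpha>)") (auto simp: wf less_osuc)

declare bfs.simps [simp del]

lemma bfs_ozero: "bfs E r ozero = ({}, {(wo_rel.minim r (Field r), wo_rel.minim r (Field r))})"
  by (subst bfs.simps) (simp add: Let_def)

lemma bfs_osuc: "bfs E r (osuc \<alpha>) = bfs_step E r (bfs E r \<alpha>)"
proof -
  have "osuc \<alpha> \<noteq> ozero"
    using less_osuc[of \<alpha>] by (metis (full_types) not_less_Least ozero_def)
  then show ?thesis
    by (subst bfs.simps) simp
qed

lemma bfs_limit:
  assumes "\<alpha> \<noteq> ozero" and "\<nexists>\<beta>. \<alpha> = osuc \<beta>"
  shows "bfs E r \<alpha> = (\<Union>\<beta>\<in>{..<\<alpha>}. fst (bfs E r \<beta>), \<Union>\<beta>\<in>{..<\<alpha>}. snd (bfs E r \<beta>))"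
  using assms by (subst bfs.simps) simp

definition bfs_B :: "'v rel \<Rightarrow> 'v rel \<Rightarrow> 'v ordinal \<Rightarrow> 'v set"
  where "bfs_B E r \<alpha> = fst (bfs E r \<alpha>)"

definition bfs_q :: "'v rel \<Rightarrow> 'v rel \<Rightarrow> 'v ordinal \<Rightarrow> 'v"
  where "bfs_q E r \<alpha> = first_unvisited (bfs E r \<alpha>)"

definition closure_ordinal :: "'v rel \<Rightarrow> 'v rel \<Rightarrow> 'v ordinal"
  where "closure_ordinal E r = (LEAST \<Gamma>. bfs_B E r \<Gamma> = bfs_B E r (osuc \<Gamma>))"

definition algorithmic_bft :: "'v rel \<Rightarrow> 'v rel \<Rightarrow> 'v rel"
  where "algorithmic_bft E r =
    {(bfs_q E r \<alpha>, bfs_q E r \<beta>) | \<alpha> \<beta>. \<alpha> \<le> \<beta> \<and> \<beta> < closure_ordinal E r}"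

end

theory Submission
  imports Defs
begin

text \<open>
  A breadth-first traversal places every vertex other than its minimum after its least neighbor,
  its parent, and lists the vertices in the order of their parents. So the only freedom left is
  the choice of the minimum and the order among siblings, the vertices with a common parent. The
  search chooses the \<open>r\<close>-least vertex as the minimum and sorts siblings by \<open>r\<close>, and it is
  therefore lexicographically least.

  In detail (\<open>lex_less_if_siblings_sorted\<close>), suppose that two breadth-first traversals \<open>a\<close> and \<open>t\<close>
  first differ at a position where they list \<open>x\<close> and \<open>y\<close>. Both list the same initial segment \<open>I\<close>
  before that position, in the same order. If \<open>I\<close> is empty, then \<open>x\<close> and \<open>y\<close> are the minima of
  the two traversals, and \<open>x\<close> is less than \<open>y\<close> if \<open>a\<close> starts with the \<open>r\<close>-least vertex. Otherwise \<open>x\<close> has its \<open>a\<close>-parent in \<open>I\<close> and \<open>y\<close> has its \<open>t\<close>-parent in \<open>I\<close>.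
  The parent of a vertex with a neighbor in \<open>I\<close> depends only on the order of \<open>I\<close>, so \<open>x\<close> and \<open>y\<close>
  have the same parents in both traversals. As \<open>x\<close> precedes \<open>y\<close> in \<open>a\<close>, the parent of \<open>x\<close> is at
  most that of \<open>y\<close>; as \<open>y\<close> precedes \<open>x\<close> in \<open>t\<close>, the reverse holds. So \<open>x\<close> and \<open>y\<close> are siblings,
  and if \<open>a\<close> sorts siblings by \<open>r\<close>, then \<open>x\<close> is less than \<open>y\<close>.

  The search is analysed through the stage at which a vertex enters the queue, here called its
  discovery. The vertices that enter together are appended in the order \<open>r\<close>, so the queue of every
  stage is the lexicographic order by discovery and then \<open>r\<close>, restricted to the vertices
  discovered so far (\<open>queue_eq\<close>). This order is visibly a wellordering, whatever the stages are.
  The visited vertices form an initial segment of the queue (\<open>B_initial_segment\<close>), so vertices are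
  visited in queue order. Since no injection maps the ordinals at hand into the vertices
  (\<open>no_injection_ordinal\<close>), the search stops; it has then visited a nonempty set closed under
  taking neighbors, which is everything by connectedness (\<open>B_closure\<close>). Hence the algorithmic
  traversal is the discovery order. A vertex other than the root is discovered just after the
  visit of its first visited neighbor, its parent (\<open>discovery_suc\<close>), so that comparing parents is
  the same as comparing discoveries. This gives both the breadth-first property and the sorting
  of siblings.
\<close>

section \<open>Ordinals\<close>

lemma ozero_le: "ozero \<le> \<alpha>"
  unfolding ozero_def by (rule Least_le) simp

lemma osuc_le_iff: "osuc \<alpha> \<le> \<beta> \<longleftrightarrow> \<alpha> < \<beta>"
proof
  show "osuc \<alpha> \<le> \<beta> \<Longrightarrow> \<alpha> < \<beta>"
    using less_osuc less_le_trans by blast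
  show "\<alpha> < \<beta> \<Longrightarrow> osuc \<alpha> \<le> \<beta>"
    unfolding osuc_def by (rule Least_le)
qed

lemma less_osuc_iff: "\<alpha> < osuc \<beta> \<longleftrightarrow> \<alpha> \<le> \<beta>"
  by (metis linorder_not_less osuc_le_iff)

lemma ordinal_induct [case_names zero suc limit]:
  fixes \<alpha> :: "'v ordinal"
  assumes "P ozero"
    and "\<And>\<alpha>. P \<alpha> \<Longrightarrow> P (osuc \<alpha>)"
    and "\<And>\<alpha>. \<alpha> \<noteq> ozero \<Longrightarrow> \<nexists>\<beta>. \<alpha> = osuc \<beta> \<Longrightarrow> (\<And>\<beta>. \<beta> < \<alpha> \<Longrightarrow> P \<beta>) \<Longrightarrow> P \<alpha>"
  shows "P \<alpha>"
  by (induction \<alpha> rule: less_induct) (metis assms less_osuc)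

lemma limit_osuc_less:
  assumes "\<nexists>\<beta>. \<alpha> = osuc \<beta>" and "\<beta> < \<alpha>"
  shows "osuc \<beta> < \<alpha>"
  using assms by (metis osuc_le_iff order_le_less)

text \<open>
  The visited and the discovered sets both arise by transfinite recursion with unions at limits;
  their growth needs to be checked at successors only.
\<close>

lemma mono_by_stages:
  fixes X :: "'v ordinal \<Rightarrow> 'a set"
  assumes suc: "\<And>\<alpha>. X \<alpha> \<subseteq> X (osuc \<alpha>)"
    and limit: "\<And>\<alpha>. \<alpha> \<noteq> ozero \<Longrightarrow> \<nexists>\<beta>. \<alpha> = osuc \<beta> \<Longrightarrow> X \<alpha> = (\<Union>\<beta>\<in>{..<\<alpha>}. X \<beta>)"
  shows "\<beta> \<le> \<alpha> \<Longrightarrow> X \<beta> \<subseteq> X \<alpha>"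
proof (induction \<alpha> rule: ordinal_induct)
  case zero
  then show ?case using ozero_le[of \<beta>] by simp
next
  case (suc \<alpha>)
  then show ?case using assms(1)[of \<alpha>] by (auto simp: le_less less_osuc_iff)
next
  case (limit \<alpha>)
  then show ?case using assms(2)[of \<alpha>] by (auto simp: le_less)
qed

text \<open>
  Hartogs' argument. An injection would carry the order of all ordinals to a well-order \<open>t\<close> on a
  set of elements of \<open>'v\<close>. Its order type is again one of the ordinals considered, say \<open>\<gamma>\<close>, so
  that all ordinals embed strictly increasingly into \<open>{..<\<gamma>}\<close>. But strictly increasing maps are
  inflationary, and \<open>\<gamma>\<close> cannot be mapped below itself.
\<close>

lemma no_injection_ordinal:
  fixes q :: "'v ordinal \<Rightarrow> 'v"
  shows "\<not> inj q"
proof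
  assume q: "inj q"
  define t where "t = dir_image {(\<alpha>, \<beta>). \<alpha> \<le> \<beta>} q"
  have Field_le: "Field {(\<alpha> :: 'v ordinal, \<beta>). \<alpha> \<le> \<beta>} = UNIV"
    by (auto simp: Field_def)
  have "Well_order {(\<alpha> :: 'v ordinal, \<beta>). \<alpha> \<le> \<beta>}"
  proof -
    have "{(\<alpha> :: 'v ordinal, \<beta>). \<alpha> \<le> \<beta>} - Id = {(\<alpha>, \<beta>). \<alpha> < \<beta>}"
      by auto
    then show ?thesis
      using wf Field_le
      by (auto simp: well_order_on_def linear_order_on_def partial_order_on_def preorder_on_def
        refl_on_def trans_def antisym_def total_on_def)
  qed
  then have t: "Well_order t"
    unfolding t_def using q by (auto intro: Well_order_dir_image inj_on_subset)
  have t_iff: "(q \<alpha>, q \<beta>) \<in> t \<longleftrightarrow> \<alpha> \<le> \<beta>" for \<alpha> \<beta>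
    using q by (auto simp: t_def dir_image_def inj_eq)
  have "Field t = range q"
    by (simp add: t_def dir_image_Field Field_le)
  obtain f where f: "enumerates f t"
    using enumerates_ex[OF t] by blast
  then obtain \<gamma> where \<gamma>: "dom f = {..<\<gamma>}"
    by (auto simp: enumerates_def)
  \<comment> \<open>\<open>g\<close> sends an ordinal to its position in the enumeration of the copy of all ordinals.\<close>
  have "\<exists>\<xi>. f \<xi> = Some (q \<alpha>)" for \<alpha>
    using f \<open>Field t = range q\<close> by (auto simp: enumerates_def ran_def set_eq_iff)
  then obtain g where g: "f (g \<alpha>) = Some (q \<alpha>)" for \<alpha>
    by metis
  have g_less: "g \<alpha> < \<gamma>" for \<alpha>
    using g[of \<alpha>] \<gamma> by (metis domI lessThan_iff)
  have g_le: "g \<alpha> \<le> g \<beta> \<longleftrightarrow> \<alpha> \<le> \<beta>" for \<alpha> \<beta>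
    using f g[of \<alpha>] g[of \<beta>] t_iff[of \<alpha> \<beta>] unfolding enumerates_def by (metis domI option.sel)
  have "\<alpha> \<le> g \<alpha>" for \<alpha>
  proof (induction \<alpha> rule: less_induct)
    case (less \<alpha>)
    then show ?case by (metis g_le linorder_not_less order_refl)
  qed
  then show False
    using g_less by (metis linorder_not_less)
qed

section \<open>Enumerations\<close>

lemma well_order_onD: "well_order_on V t \<Longrightarrow> Field t = V" "well_order_on V t \<Longrightarrow> Well_order t"
  using well_order_on_Well_order by metis+

lemma enumerates_underS:
  assumes f: "enumerates f t" and t: "Well_order t" and x: "f \<xi> = Some x"
  shows "underS t x = {v. \<exists>\<eta><\<xi>. f \<eta> = Some v}"
proof -
  have *: "\<eta> \<le> \<eta>' \<longleftrightarrow> (v, w) \<in> t" if "f \<eta> = Some v" "f \<eta>' = Some w" for \<eta> \<eta>' v w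
    using f that unfolding enumerates_def by (metis domI option.sel)
  have ran: "\<exists>\<eta>. f \<eta> = Some v" if "v \<in> Field t" for v
    using f that by (auto simp: enumerates_def ran_def set_eq_iff)
  show ?thesis
  proof (intro set_eqI iffI)
    fix v assume v: "v \<in> underS t x"
    then obtain \<eta> where \<eta>: "f \<eta> = Some v"
      using ran[of v] by (auto simp: underS_def Field_def)
    then have "\<eta> \<le> \<xi>" "\<eta> \<noteq> \<xi>"
      using v x *[OF \<eta> x] by (auto simp: underS_def)
    then show "v \<in> {v. \<exists>\<eta><\<xi>. f \<eta> = Some v}"
      using \<eta> by (auto simp: less_le)
  next
    fix v assume "v \<in> {v. \<exists>\<eta><\<xi>. f \<eta> = Some v}"
    then obtain \<eta> where \<eta>: "\<eta> < \<xi>" "f \<eta> = Some v"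
      by blast
    then have "\<not> \<xi> \<le> \<eta>" "\<eta> \<le> \<xi>" by auto
    then have "(v, x) \<in> t" "v \<noteq> x"
      using *[OF \<eta>(2) x] *[OF x \<eta>(2)] *[OF \<eta>(2) \<eta>(2)] *[OF x x] by auto
    then show "v \<in> underS t x"
      by (simp add: underS_def)
  qed
qed

lemma enumerates_relation:
  assumes f: "enumerates f t"
  shows "t = {(v, w). \<exists>\<xi> \<eta>. \<xi> \<le> \<eta> \<and> f \<xi> = Some v \<and> f \<eta> = Some w}"
proof -
  have *: "\<eta> \<le> \<eta>' \<longleftrightarrow> (v, w) \<in> t" if "f \<eta> = Some v" "f \<eta>' = Some w" for \<eta> \<eta>' v w
    using f that unfolding enumerates_def by (metis domI option.sel)
  have ran: "\<exists>\<eta>. f \<eta> = Some v" if "v \<in> Field t" for v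
    using f that by (auto simp: enumerates_def ran_def set_eq_iff)
  have "\<exists>\<xi> \<eta>. \<xi> \<le> \<eta> \<and> f \<xi> = Some v \<and> f \<eta> = Some w" if "(v, w) \<in> t" for v w
  proof -
    have "v \<in> Field t" "w \<in> Field t"
      using that by (auto simp: Field_def)
    then obtain \<xi> \<eta> where "f \<xi> = Some v" "f \<eta> = Some w"
      using ran by blast
    moreover from this have "\<xi> \<le> \<eta>"
      using *[of \<xi> v \<eta> w] that by simp
    ultimately show ?thesis
      by blast
  qed
  moreover have "(v, w) \<in> t" if "\<xi> \<le> \<eta>" "f \<xi> = Some v" "f \<eta> = Some w" for v w \<xi> \<eta>
    using *[OF that(2,3)] that(1) by simp
  ultimately show ?thesis
    by auto
qed

text \<open>
  An enumeration cannot end at a position where another enumeration of the same set, agreeing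
  with it so far, lists a further element: that element would still have to be listed.
\<close>

lemma enumerates_defined_together:
  assumes f: "enumerates f t" and g: "enumerates g t'" and "Field t = Field t'"
    and agree: "\<And>\<eta>. \<eta> < \<xi> \<Longrightarrow> f \<eta> = g \<eta>" and x: "f \<xi> = Some x"
  shows "\<exists>y. g \<xi> = Some y"
proof -
  have "x \<in> ran g"
    using f g x \<open>Field t = Field t'\<close> by (auto simp: enumerates_def intro: ranI)
  then obtain \<zeta> where \<zeta>: "g \<zeta> = Some x"
    by (auto simp: ran_def)
  have "\<not> \<zeta> < \<xi>"
  proof
    assume "\<zeta> < \<xi>"
    then have "f \<zeta> = f \<xi>"
      using agree \<zeta> x by simp
    then have "\<zeta> = \<xi>"
      using f x unfolding enumerates_def by (metis domI inj_onD)
    then show False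
      using \<open>\<zeta> < \<xi>\<close> by simp
  qed
  moreover obtain \<gamma> where "dom g = {..<\<gamma>}"
    using g by (auto simp: enumerates_def)
  ultimately have "\<xi> \<in> dom g"
    using \<zeta> by (metis domI lessThan_iff linorder_not_less order_le_less_trans)
  then show ?thesis by blast
qed

text \<open>
  The lexicographic comparison of enumerations, expressed without ordinals: the position of the
  first disagreement only matters through the common initial segment \<open>underS t x\<close> before it.
\<close>

lemma first_disagreement:
  assumes t: "well_order_on V t" and t': "well_order_on V t'" and "t \<noteq> t'"
  obtains x y where "x \<in> V" "y \<in> V" "x \<noteq> y" "underS t x = underS t' y"
    "Restr t (underS t x) = Restr t' (underS t x)"
    "\<And>r. (x, y) \<in> r \<Longrightarrow> lex_less r t t'"
proof -
  have V: "Field t = V" "Field t' = V" and wo: "Well_order t" "Well_order t'"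
    using t t' by (simp_all add: well_order_onD)
  define f f' where "f = enumeration t" and "f' = enumeration t'"
  have f: "enumerates f t" and f': "enumerates f' t'"
    unfolding f_def f'_def using wo by (simp_all add: enumerates_enumeration)
  have "f \<noteq> f'"
    using enumerates_relation[OF f] enumerates_relation[OF f'] \<open>t \<noteq> t'\<close> by auto
  define \<xi> where "\<xi> = (LEAST \<xi>. f \<xi> \<noteq> f' \<xi>)"
  have \<xi>: "f \<xi> \<noteq> f' \<xi>"
    unfolding \<xi>_def by (rule LeastI_ex) (use \<open>f \<noteq> f'\<close> in \<open>auto simp: fun_eq_iff\<close>)
  have agree: "f \<eta> = f' \<eta>" if "\<eta> < \<xi>" for \<eta>
    using not_less_Least[OF that[unfolded \<xi>_def]] by simp
  obtain x y where x: "f \<xi> = Some x" and y: "f' \<xi> = Some y"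
    using enumerates_defined_together[OF f f', of \<xi>] enumerates_defined_together[OF f' f, of \<xi>]
      \<xi> agree V by (metis not_None_eq)
  have I: "underS t x = {v. \<exists>\<eta><\<xi>. f \<eta> = Some v}" "underS t' y = {v. \<exists>\<eta><\<xi>. f \<eta> = Some v}"
    using enumerates_underS[OF f wo(1) x] enumerates_underS[OF f' wo(2) y] agree by auto
  have restr: "(v, w) \<in> t \<longleftrightarrow> (v, w) \<in> t'" if "v \<in> underS t x" "w \<in> underS t x" for v w
  proof -
    obtain \<eta> \<zeta> where *: "\<eta> < \<xi>" "f \<eta> = Some v" "\<zeta> < \<xi>" "f \<zeta> = Some w"
      using \<open>v \<in> _\<close> \<open>w \<in> _\<close> I by blast
    then have "f' \<eta> = Some v" "f' \<zeta> = Some w"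
      using agree by auto
    then have "\<eta> \<le> \<zeta> \<longleftrightarrow> (v, w) \<in> t'"
      using f' unfolding enumerates_def by (metis domI option.sel)
    moreover have "\<eta> \<le> \<zeta> \<longleftrightarrow> (v, w) \<in> t"
      using * f unfolding enumerates_def by (metis domI option.sel)
    ultimately show ?thesis by simp
  qed
  show thesis
  proof
    show "x \<in> V" "y \<in> V"
      using f f' x y V by (auto simp: enumerates_def intro: ranI)
    show "x \<noteq> y" "underS t x = underS t' y"
      using \<xi> x y I by auto
    show "Restr t (underS t x) = Restr t' (underS t x)"
      using restr by auto
    show "lex_less r t t'" if "(x, y) \<in> r" for r
      using that \<open>f \<noteq> f'\<close> \<xi> x y
      unfolding lex_less_def Let_def f_def[symmetric] f'_def[symmetric] \<xi>_def[symmetric] by auto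
  qed
qed

section \<open>Wellordered traversals\<close>

lemma minim_eqI:
  assumes "well_order_on V t" and "x \<in> A" and "A \<subseteq> V" and "\<And>y. y \<in> A \<Longrightarrow> (x, y) \<in> t"
  shows "wo_rel.minim t A = x"
proof -
  interpret wo_rel t
    using well_order_onD(2)[OF assms(1)] by (rule wo_rel.intro)
  show ?thesis
    using equals_minim[of A x] assms well_order_onD(1)[OF assms(1)] by simp
qed

lemma minim_least:
  assumes "well_order_on V t" and "A \<subseteq> V" and "y \<in> A"
  shows "wo_rel.minim t A \<in> A" and "(wo_rel.minim t A, y) \<in> t"
proof -
  interpret wo_rel t
    using well_order_onD(2)[OF assms(1)] by (rule wo_rel.intro)
  show "wo_rel.minim t A \<in> A" and "(wo_rel.minim t A, y) \<in> t"
    using minim_in[of A] minim_least[of A y] assms well_order_onD(1)[OF assms(1)] by auto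
qed

lemma well_order_on_antisym:
  "well_order_on V t \<Longrightarrow> (x, y) \<in> t \<Longrightarrow> (y, x) \<in> t \<Longrightarrow> x = y"
  by (auto simp: well_order_on_def linear_order_on_def partial_order_on_def dest: antisymD)

lemma well_order_on_refl: "well_order_on V t \<Longrightarrow> x \<in> V \<Longrightarrow> (x, x) \<in> t"
  by (auto simp: well_order_on_def linear_order_on_def partial_order_on_def preorder_on_def
      dest: refl_onD)

lemma well_order_on_trans:
  "well_order_on V t \<Longrightarrow> (x, y) \<in> t \<Longrightarrow> (y, z) \<in> t \<Longrightarrow> (x, z) \<in> t"
  by (auto simp: well_order_on_def linear_order_on_def partial_order_on_def preorder_on_def
      dest: transD)

lemma well_order_on_linear:
  "well_order_on V t \<Longrightarrow> x \<in> V \<Longrightarrow> y \<in> V \<Longrightarrow> (x, y) \<in> t \<or> (y, x) \<in> t"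
  using well_order_on_refl[of V t x]
  by (auto simp: well_order_on_def linear_order_on_def total_on_def)

lemma well_order_on_in:
  assumes "well_order_on V t" and "(x, y) \<in> t"
  shows "x \<in> V" and "y \<in> V"
  using assms(2) well_order_onD(1)[OF assms(1)] by (auto simp: Field_def)

text \<open>
  Connectedness of the initial segments is a local condition. In the initial segment that ends with
  \<open>w\<close>, a path from \<open>w\<close> to the minimum starts with a step to an earlier neighbor. Conversely, going
  from neighbor to earlier neighbor stays within any initial segment and, by wellfoundedness,
  reaches the minimum.
\<close>

lemma wellordered_traversal_iff_earlier_neighbor:
  assumes G: "undirected_graph V E" and t: "well_order_on V t"
  shows "wellordered_traversal V E t \<longleftrightarrow>
    (\<forall>w\<in>V - {wo_rel.minim t V}. \<exists>u\<in>E `` {w}. (u, w) \<in> t)"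
proof -
  define m where "m = wo_rel.minim t V"
  have m: "m \<in> V" "(m, v) \<in> t" if "v \<in> V" for v
    using minim_least[OF t, of V v] that by (auto simp: m_def)
  have sym: "sym (Restr E S)" for S
    using G by (auto simp: undirected_graph_def sym_def)
  have Field: "Field t = V"
    by (rule well_order_onD(1)[OF t])
  show ?thesis
    unfolding m_def[symmetric]
  proof
    assume trav: "wellordered_traversal V E t"
    show "\<forall>w\<in>V - {m}. \<exists>u\<in>E `` {w}. (u, w) \<in> t"
    proof
      fix w assume w: "w \<in> V - {m}"
      interpret wo_rel t
        using well_order_onD(2)[OF t] by (rule wo_rel.intro)
      have "induces_connected E (under w)"
        using trav under_ofilter by (auto simp: wellordered_traversal_def)
      moreover have "w \<in> under w" "m \<in> under w"
        using w m well_order_on_refl[OF t, of w] by (auto simp: under_def)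
      ultimately have "(w, m) \<in> (Restr E (under w))\<^sup>*"
        by (auto simp: induces_connected_def)
      then show "\<exists>u\<in>E `` {w}. (u, w) \<in> t"
        using w by (cases rule: converse_rtranclE) (auto simp: under_def)
    qed
  next
    assume earlier: "\<forall>w\<in>V - {m}. \<exists>u\<in>E `` {w}. (u, w) \<in> t"
    have "induces_connected E S" if S: "ofilter t S" for S
    proof -
      have down: "u \<in> S" if "(u, w) \<in> t" "w \<in> S" for u w
        using S that by (auto simp: ofilter_def under_def)
      have "S \<subseteq> V"
        using S Field by (auto simp: ofilter_def)
      have wf: "wf (t - Id)"
        using t by (simp add: well_order_on_def)
      have to_min: "w \<in> S \<longrightarrow> (w, m) \<in> (Restr E S)\<^sup>*" for w
        using wf
      proof (induction w rule: wf_induct_rule)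
        case (less w)
        show ?case
        proof (intro impI)
          assume w: "w \<in> S"
          show "(w, m) \<in> (Restr E S)\<^sup>*"
          proof (cases "w = m")
            case False
            then obtain u where u: "(w, u) \<in> E" "(u, w) \<in> t"
              using earlier w \<open>S \<subseteq> V\<close> by blast
            then have "u \<in> S" "u \<noteq> w"
              using down w G by (auto simp: undirected_graph_def irrefl_def)
            then show ?thesis
              using less[of u] u w by (auto intro: converse_rtrancl_into_rtrancl)
          qed simp
        qed
      qed
      have "(m, w) \<in> (Restr E S)\<^sup>*" if "w \<in> S" for w
        using to_min[of w] that sym_rtrancl[OF sym[of S]] by (auto dest: symD)
      then show ?thesis
        using to_min unfolding induces_connected_def by (meson rtrancl_trans)
    qed
    then show "wellordered_traversal V E t"
      using t by (simp add: wellordered_traversal_def)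
  qed
qed

lemma least_neighbor_earlier:
  assumes G: "undirected_graph V E" and trav: "wellordered_traversal V E t"
    and w: "w \<in> V" "w \<noteq> wo_rel.minim t V"
  shows "least_neighbor E t w \<in> underS t w"
proof -
  have t: "well_order_on V t"
    using trav by (simp add: wellordered_traversal_def)
  obtain u where u: "u \<in> E `` {w}" "(u, w) \<in> t"
    using trav w wellordered_traversal_iff_earlier_neighbor[OF G t] by blast
  have "E `` {w} \<subseteq> V"
    using G by (auto simp: undirected_graph_def)
  note least = minim_least[OF t this u(1), folded least_neighbor_def]
  have "least_neighbor E t w \<noteq> w"
    using least(1) G by (auto simp: undirected_graph_def irrefl_def)
  then show ?thesis
    using well_order_on_trans[OF t least(2) u(2)] by (simp add: underS_def)
qed

text \<open>
  A least neighbor \<open>p\<close> that lies in a common part \<open>I\<close> of two wellorderings stays the least in \<open>t'\<close>: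
  the neighbors in \<open>I\<close> are compared alike, and all others come after the initial segment \<open>I\<close>.
\<close>

lemma least_neighbor_cong:
  assumes G: "undirected_graph V E" and t: "well_order_on V t" and t': "well_order_on V t'"
    and I: "ofilter t' I" and agree: "Restr t I = Restr t' I"
    and p: "least_neighbor E t w \<in> I" and w: "E `` {w} \<noteq> {}"
  shows "least_neighbor E t' w = least_neighbor E t w"
  unfolding least_neighbor_def[of E t']
proof (rule minim_eqI[OF t'])
  let ?p = "least_neighbor E t w"
  show N: "E `` {w} \<subseteq> V"
    using G by (auto simp: undirected_graph_def)
  show pN: "?p \<in> E `` {w}"
    using minim_least(1)[OF t N] w by (auto simp: least_neighbor_def)
  fix u assume u: "u \<in> E `` {w}"
  show "(?p, u) \<in> t'"
  proof (cases "u \<in> I")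
    case True
    have "(?p, u) \<in> t"
      using minim_least(2)[OF t N u] by (simp add: least_neighbor_def)
    then have "(?p, u) \<in> Restr t I"
      using p True by auto
    then show ?thesis
      using agree by auto
  next
    case False
    then have "(u, ?p) \<notin> t'"
      using p I by (auto simp: ofilter_def under_def)
    then show ?thesis
      using well_order_on_linear[OF t'] pN u N by blast
  qed
qed

text \<open>
  At the first disagreement, breadth-first traversals list siblings: monotonicity of the least
  neighbor function in each of the traversals yields one of the two comparisons between the
  parents of \<open>x\<close> and \<open>y\<close>.
\<close>

lemma lex_less_if_siblings_sorted:
  assumes G: "undirected_graph V E" and r: "well_order_on V r"
    and a: "breadth_first_traversal V E a"
    and root: "wo_rel.minim a V = wo_rel.minim r V"
    and siblings: "\<And>v w. (v, w) \<in> a \<Longrightarrow> v \<noteq> wo_rel.minim a V \<Longrightarrow> w \<noteq> wo_rel.minim a V \<Longrightarrow>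
      least_neighbor E a v = least_neighbor E a w \<Longrightarrow> (v, w) \<in> r"
    and t: "breadth_first_traversal V E t" and "t \<noteq> a"
  shows "lex_less r a t"
proof -
  have trav: "wellordered_traversal V E a" "wellordered_traversal V E t"
    using a t by (auto simp: breadth_first_traversal_def)
  then have wa: "well_order_on V a" and wt: "well_order_on V t"
    by (auto simp: wellordered_traversal_def)
  obtain x y where xy: "x \<in> V" "y \<in> V" "x \<noteq> y" and I: "underS a x = underS t y"
    and agree: "Restr a (underS a x) = Restr t (underS a x)"
    and less: "(x, y) \<in> r \<Longrightarrow> lex_less r a t"
    using first_disagreement[OF wa wt] \<open>t \<noteq> a\<close> by metis
  have filt: "ofilter a (underS a x)" "ofilter t (underS a x)"
    using wo_rel.underS_ofilter[OF wo_rel.intro[OF well_order_onD(2)[OF wa]], of x]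
      wo_rel.underS_ofilter[OF wo_rel.intro[OF well_order_onD(2)[OF wt]], of y] I
    by simp_all
  \<comment> \<open>Each of \<open>x\<close> and \<open>y\<close> is the first vertex of its traversal outside the common segment.\<close>
  have x_le: "(x, w) \<in> a" if "w \<in> V" "w \<notin> underS a x" for w
    using well_order_on_linear[OF wa \<open>x \<in> V\<close> \<open>w \<in> V\<close>] that well_order_on_refl[OF wa]
    by (auto simp: underS_def)
  have y_le: "(y, w) \<in> t" if "w \<in> V" "w \<notin> underS a x" for w
    using well_order_on_linear[OF wt \<open>y \<in> V\<close> \<open>w \<in> V\<close>] that well_order_on_refl[OF wt]
    unfolding I by (auto simp: underS_def)
  have x_y: "(x, y) \<in> a" and y_x: "(y, x) \<in> t"
    using x_le[of y] y_le[of x] xy I by (auto simp: underS_def)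
  have "(x, y) \<in> r"
  proof (cases "underS a x = {}")
    case True
    then have "wo_rel.minim a V = x"
      using x_le minim_eqI[OF wa \<open>x \<in> V\<close>] by auto
    then show ?thesis
      using root minim_least(2)[OF r, of V y] xy by auto
  next
    case False
    have "\<not> (x, z) \<in> a" if "z \<in> underS a x" for z
      using that well_order_on_antisym[OF wa] by (auto simp: underS_def)
    moreover have "\<not> (y, z) \<in> t" if "z \<in> underS a x" for z
      using that well_order_on_antisym[OF wt] unfolding I by (auto simp: underS_def)
    moreover have "underS a x \<subseteq> V"
      using well_order_on_in[OF wa] by (auto simp: underS_def)
    moreover have "wo_rel.minim a V \<in> V" "wo_rel.minim t V \<in> V"
      using minim_least(1)[OF wa, of V x] minim_least(1)[OF wt, of V x] xy by auto
    ultimately have "wo_rel.minim a V \<in> underS a x" "wo_rel.minim t V \<in> underS a x"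
      using False x_le[of "wo_rel.minim a V"] y_le[of "wo_rel.minim t V"]
        minim_least(2)[OF wa, of V] minim_least(2)[OF wt, of V]
        well_order_on_trans[OF wa] well_order_on_trans[OF wt] by blast+
    then have nonmin: "x \<noteq> wo_rel.minim a V" "y \<noteq> wo_rel.minim a V"
        "x \<noteq> wo_rel.minim t V" "y \<noteq> wo_rel.minim t V"
      using I by (auto simp: underS_def)
    have px: "least_neighbor E a x \<in> underS a x" and py: "least_neighbor E t y \<in> underS a x"
      using least_neighbor_earlier[OF G trav(1), of x] least_neighbor_earlier[OF G trav(2), of y]
        nonmin xy I by auto
    have "E `` {x} \<noteq> {}" "E `` {y} \<noteq> {}"
      using trav wellordered_traversal_iff_earlier_neighbor[OF G wa] nonmin xy by blast+
    then have p: "least_neighbor E t x = least_neighbor E a x"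
        "least_neighbor E a y = least_neighbor E t y"
      using least_neighbor_cong[OF G wa wt filt(2) agree px]
        least_neighbor_cong[OF G wt wa filt(1) agree[symmetric] py] by auto
    have "(least_neighbor E a x, least_neighbor E a y) \<in> a"
      using a x_y nonmin xy by (auto simp: breadth_first_traversal_def)
    moreover have "(least_neighbor E t y, least_neighbor E t x) \<in> t"
      using t y_x nonmin xy by (auto simp: breadth_first_traversal_def)
    then have "(least_neighbor E a y, least_neighbor E a x) \<in> Restr t (underS a x)"
      using px py p by simp
    then have "(least_neighbor E a y, least_neighbor E a x) \<in> a"
      unfolding agree[symmetric] by simp
    ultimately have "least_neighbor E a x = least_neighbor E a y"
      by (rule well_order_on_antisym[OF wa])
    then show ?thesis
      using siblings x_y nonmin by blast
  qed
  then show ?thesis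
    by (rule less)
qed

section \<open>The order of discovery in breadth-first search\<close>

text \<open>
  The rank \<open>e\<close> is arbitrary. Hence the discovery order below is a wellordering of all of \<open>V\<close> before
  it is known that the search discovers every vertex.
\<close>

lemma well_order_on_rank_lex:
  fixes e :: "'a \<Rightarrow> 'b :: wellorder"
  assumes r: "well_order_on V r"
  shows "well_order_on V {(v, w) \<in> V \<times> V. e v < e w \<or> e v = e w \<and> (v, w) \<in> r}"
    (is "well_order_on V ?L")
proof -
  have "?L - Id \<subseteq> inv_image ({(x, y). x < y} <*lex*> (r - Id)) (\<lambda>v. (e v, v))"
    by auto
  moreover have "wf (r - Id)"
    using r by (simp add: well_order_on_def)
  ultimately have "wf (?L - Id)"
    using wf by (meson wf_inv_image wf_lex_prod wf_subset)
  moreover have "trans ?L"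
    by (intro transI) (auto dest: less_trans well_order_on_trans[OF r])
  moreover have "antisym ?L"
    by (intro antisymI) (auto dest: well_order_on_antisym[OF r])
  moreover have "total_on V ?L"
    using well_order_on_linear[OF r] by (auto simp: total_on_def)
  moreover have "?L \<subseteq> V \<times> V"
    by auto
  moreover have "refl_on V ?L"
    using well_order_on_refl[OF r] by (auto simp: refl_on_def)
  ultimately show ?thesis
    by (auto simp: well_order_on_def linear_order_on_def partial_order_on_def preorder_on_def)
qed

locale graph_search =
  fixes V :: "'v set" and E r :: "'v rel"
  assumes graph: "wellordered_connected_graph V E r" and nonempty: "V \<noteq> {}"
begin

lemma undirected: "undirected_graph V E" and wo_r: "well_order_on V r"
  and connected: "induces_connected E V"
  using graph by (simp_all add: wellordered_connected_graph_def)

lemma E_subset: "E \<subseteq> V \<times> V"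
  using undirected by (simp add: undirected_graph_def)

abbreviation root :: 'v where "root \<equiv> wo_rel.minim r V"

abbreviation B :: "'v ordinal \<Rightarrow> 'v set" where "B \<equiv> bfs_B E r"

abbreviation q :: "'v ordinal \<Rightarrow> 'v" where "q \<equiv> bfs_q E r"

definition queue :: "'v ordinal \<Rightarrow> 'v rel" where "queue \<alpha> = snd (bfs E r \<alpha>)"

definition discovered :: "'v ordinal \<Rightarrow> 'v set" where "discovered \<alpha> = Field (queue \<alpha>)"

lemma bfs_eq: "bfs E r \<alpha> = (B \<alpha>, queue \<alpha>)"
  by (simp add: bfs_B_def queue_def)

lemma root: "root \<in> V" "v \<in> V \<Longrightarrow> (root, v) \<in> r"
  using minim_least[OF wo_r, of V] nonempty by auto

lemma zero_stage: "B ozero = {}" "queue ozero = {(root, root)}"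
  using well_order_onD(1)[OF wo_r] by (simp_all add: bfs_B_def queue_def bfs_ozero)

lemma discovered_zero: "discovered ozero = {root}"
  by (simp add: discovered_def zero_stage)

lemma suc_stage:
  "B (osuc \<alpha>) = (if discovered \<alpha> \<subseteq> B \<alpha> then B \<alpha> else insert (q \<alpha>) (B \<alpha>))"
  "queue (osuc \<alpha>) = (if discovered \<alpha> \<subseteq> B \<alpha> then queue \<alpha>
     else append_in_order r (queue \<alpha>) (E `` {q \<alpha>} - discovered \<alpha>))"
proof -
  have "bfs E r (osuc \<alpha>) = (if discovered \<alpha> \<subseteq> B \<alpha> then (B \<alpha>, queue \<alpha>)
      else (insert (q \<alpha>) (B \<alpha>), append_in_order r (queue \<alpha>) (E `` {q \<alpha>} - discovered \<alpha>)))"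
    by (auto simp: bfs_osuc bfs_step_def bfs_q_def bfs_eq discovered_def Let_def)
  then show "B (osuc \<alpha>) = (if discovered \<alpha> \<subseteq> B \<alpha> then B \<alpha> else insert (q \<alpha>) (B \<alpha>))"
    "queue (osuc \<alpha>) = (if discovered \<alpha> \<subseteq> B \<alpha> then queue \<alpha>
     else append_in_order r (queue \<alpha>) (E `` {q \<alpha>} - discovered \<alpha>))"
    by (auto simp: bfs_eq split: if_splits)
qed

lemma discovered_suc:
  "discovered (osuc \<alpha>) = (if discovered \<alpha> \<subseteq> B \<alpha> then discovered \<alpha> else discovered \<alpha> \<union> E `` {q \<alpha>})"
proof -
  have "Field (append_in_order r Q N) = Field Q \<union> N" if "N \<subseteq> V" for Q N
  proof -
    have "Field (Restr r N) = N"
      using that well_order_on_refl[OF wo_r] by (auto simp: Field_def)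
    moreover have "Field (Field Q \<times> N) \<subseteq> Field Q \<union> N"
      by (auto simp: Field_def)
    ultimately show ?thesis
      by (auto simp: append_in_order_def)
  qed
  moreover have "E `` {q \<alpha>} - discovered \<alpha> \<subseteq> V"
    using E_subset by auto
  ultimately show ?thesis
    unfolding discovered_def[of "osuc \<alpha>"] by (auto simp: suc_stage discovered_def)
qed

lemma limit_stage:
  assumes "\<alpha> \<noteq> ozero" and "\<nexists>\<beta>. \<alpha> = osuc \<beta>"
  shows "B \<alpha> = (\<Union>\<beta>\<in>{..<\<alpha>}. B \<beta>)" and "queue \<alpha> = (\<Union>\<beta>\<in>{..<\<alpha>}. queue \<beta>)"
    and "discovered \<alpha> = (\<Union>\<beta>\<in>{..<\<alpha>}. discovered \<beta>)"
proof -
  show "B \<alpha> = (\<Union>\<beta>\<in>{..<\<alpha>}. B \<beta>)" and *: "queue \<alpha> = (\<Union>\<beta>\<in>{..<\<alpha>}. queue \<beta>)"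
    by (simp_all add: bfs_B_def queue_def bfs_limit[OF assms])
  then show "discovered \<alpha> = (\<Union>\<beta>\<in>{..<\<alpha>}. discovered \<beta>)"
    by (auto simp: discovered_def Field_def)
qed

lemma B_mono: "\<beta> \<le> \<alpha> \<Longrightarrow> B \<beta> \<subseteq> B \<alpha>"
  by (rule mono_by_stages) (auto simp: suc_stage limit_stage(1))

lemma discovered_mono: "\<beta> \<le> \<alpha> \<Longrightarrow> discovered \<beta> \<subseteq> discovered \<alpha>"
  by (rule mono_by_stages) (auto simp: discovered_suc limit_stage(3))

lemma discovered_subset: "discovered \<alpha> \<subseteq> V"
proof (induction \<alpha> rule: ordinal_induct)
  case zero
  then show ?case using root by (simp add: discovered_zero)
next
  case (suc \<alpha>)
  then show ?case using E_subset by (auto simp: discovered_suc)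
next
  case (limit \<alpha>)
  then show ?case by (auto simp: limit_stage(3))
qed

text \<open>
  The value at a vertex that is never discovered is a junk value; it does no harm because
  statements about discoveries are restricted to discovered vertices until \<open>B_closure\<close> shows that
  all vertices are discovered.
\<close>

definition discovery :: "'v \<Rightarrow> 'v ordinal" where
  "discovery v = (LEAST \<alpha>. v \<in> discovered \<alpha>)"

lemma discovery_le: "v \<in> discovered \<alpha> \<Longrightarrow> discovery v \<le> \<alpha>"
  unfolding discovery_def by (rule Least_le)

lemma discovered_discovery: "v \<in> discovered \<alpha> \<Longrightarrow> v \<in> discovered (discovery v)"
  unfolding discovery_def by (rule LeastI)

lemma discovered_iff: "v \<in> discovered \<alpha> \<Longrightarrow> v \<in> discovered \<beta> \<longleftrightarrow> discovery v \<le> \<beta>"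
  using discovery_le discovered_discovery discovered_mono by blast

definition discovery_order :: "'v rel" where
  "discovery_order = {(v, w) \<in> V \<times> V. discovery v < discovery w \<or> discovery v = discovery w \<and> (v, w) \<in> r}"

lemma wo_discovery_order: "well_order_on V discovery_order"
  unfolding discovery_order_def by (rule well_order_on_rank_lex[OF wo_r])

text \<open>
  Vertices appended at stage \<open>osuc \<alpha>\<close> have discovery exactly \<open>osuc \<alpha>\<close>, so they come after the
  earlier ones and are ordered by \<open>r\<close> among themselves, just as in \<open>append_in_order\<close>. At limits, two
  vertices of the union already lie in a common earlier queue.
\<close>

lemma queue_eq: "queue \<alpha> = Restr discovery_order (discovered \<alpha>)"
proof (induction \<alpha> rule: ordinal_induct)
  case zero
  then show ?case
    using root well_order_on_refl[OF wo_discovery_order] by (auto simp: zero_stage discovered_zero)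
next
  case (suc \<alpha>)
  show ?case
  proof (cases "discovered \<alpha> \<subseteq> B \<alpha>")
    case True
    then show ?thesis using suc by (simp add: suc_stage discovered_suc)
  next
    case False
    define N where "N = E `` {q \<alpha>} - discovered \<alpha>"
    have new: "discovered (osuc \<alpha>) = discovered \<alpha> \<union> N"
      using False by (auto simp: N_def discovered_suc)
    have old: "discovery v < osuc \<alpha>" "osuc \<alpha> \<noteq> discovery v"
      "\<not> osuc \<alpha> < discovery v" if "v \<in> discovered \<alpha>" for v
      using discovery_le[OF that] less_osuc[of \<alpha>] by auto
    have fresh: "discovery v = osuc \<alpha>" if "v \<in> N" for v
    proof -
      have v: "v \<in> discovered (osuc \<alpha>)" "v \<notin> discovered \<alpha>"
        using that new by (auto simp: N_def)
      then show ?thesis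
        using discovered_iff[OF v(1), of \<alpha>] discovery_le[OF v(1)]
        by (simp add: not_le order_antisym osuc_le_iff)
    qed
    have "N \<subseteq> V" "discovered \<alpha> \<subseteq> V"
      using discovered_subset[of "osuc \<alpha>"] new by auto
    then have "Restr discovery_order (discovered \<alpha> \<union> N) =
        Restr discovery_order (discovered \<alpha>) \<union> discovered \<alpha> \<times> N \<union> Restr r N"
      using old by (auto simp: discovery_order_def fresh)
    moreover have "queue (osuc \<alpha>) = queue \<alpha> \<union> discovered \<alpha> \<times> N \<union> Restr r N"
      using False by (simp add: suc_stage append_in_order_def N_def discovered_def[symmetric])
    ultimately show ?thesis
      using suc by (simp add: new)
  qed
next
  case (limit \<alpha>)
  have "\<exists>\<gamma><\<alpha>. v \<in> discovered \<gamma> \<and> w \<in> discovered \<gamma>"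
    if vw: "v \<in> discovered \<alpha>" "w \<in> discovered \<alpha>" for v w
  proof -
    obtain \<beta> \<gamma> where "\<beta> < \<alpha>" "\<gamma> < \<alpha>" "v \<in> discovered \<beta>" "w \<in> discovered \<gamma>"
      using vw limit_stage(3)[OF limit(1,2)] by auto
    then show ?thesis
      using discovered_mono[of \<beta> \<gamma>] discovered_mono[of \<gamma> \<beta>] linear[of \<beta> \<gamma>] by blast
  qed
  then have "discovered \<alpha> \<times> discovered \<alpha> = (\<Union>\<beta>\<in>{..<\<alpha>}. discovered \<beta> \<times> discovered \<beta>)"
    using discovered_mono[OF less_imp_le, of _ \<alpha>] by blast
  then have "Restr discovery_order (discovered \<alpha>) =
      (\<Union>\<beta>\<in>{..<\<alpha>}. Restr discovery_order (discovered \<beta>))"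
    by (simp only: Int_UN_distrib)
  also have "\<dots> = (\<Union>\<beta>\<in>{..<\<alpha>}. queue \<beta>)"
    using limit.IH by (intro SUP_cong) auto
  finally show ?case
    by (simp only: limit_stage(2)[OF limit(1,2)])
qed

lemma q_least:
  assumes "\<not> discovered \<alpha> \<subseteq> B \<alpha>"
  shows "q \<alpha> \<in> discovered \<alpha> - B \<alpha>"
    and "v \<in> discovered \<alpha> - B \<alpha> \<Longrightarrow> (q \<alpha>, v) \<in> discovery_order"
proof -
  have "Well_order (queue \<alpha>)"
    unfolding queue_eq by (rule Well_order_Restr[OF well_order_onD(2)[OF wo_discovery_order]])
  then have wo: "well_order_on (discovered \<alpha>) (queue \<alpha>)"
    by (simp add: discovered_def)
  have q: "q \<alpha> = wo_rel.minim (queue \<alpha>) (discovered \<alpha> - B \<alpha>)"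
    by (simp add: bfs_q_def first_unvisited_def bfs_eq discovered_def)
  obtain u where u: "u \<in> discovered \<alpha> - B \<alpha>"
    using assms by blast
  show "q \<alpha> \<in> discovered \<alpha> - B \<alpha>"
    unfolding q by (rule minim_least(1)[OF wo _ u]) blast
  show "(q \<alpha>, v) \<in> discovery_order" if "v \<in> discovered \<alpha> - B \<alpha>"
    using minim_least(2)[OF wo _ that] unfolding q queue_eq by blast
qed

lemma B_subset_discovered: "B \<alpha> \<subseteq> discovered \<alpha>"
proof (induction \<alpha> rule: ordinal_induct)
  case (suc \<alpha>)
  then show ?case
    using q_least(1)[of \<alpha>] by (auto simp: suc_stage discovered_suc)
qed (auto simp: zero_stage limit_stage)

text \<open>
  The order in which vertices leave the queue is the order in which they enter it. At a successor
  stage the vertex \<open>v\<close> cannot be newly discovered, because it precedes \<open>w\<close>, which was discovered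
  before; hence it competes with \<open>w\<close> for being the first unvisited vertex.
\<close>

lemma B_initial_segment:
  "w \<in> B \<alpha> \<Longrightarrow> v \<in> discovered \<alpha> \<Longrightarrow> (v, w) \<in> discovery_order \<Longrightarrow> v \<in> B \<alpha>"
proof (induction \<alpha> arbitrary: v w rule: ordinal_induct)
  case zero
  then show ?case by (simp add: zero_stage)
next
  case (suc \<alpha>)
  have "w \<in> discovered \<alpha>"
    using suc.prems(1) B_subset_discovered q_least(1)[of \<alpha>] by (auto simp: suc_stage split: if_splits)
  then have "discovery v \<le> \<alpha>"
    using suc.prems(3) discovery_le[of w \<alpha>] by (auto simp: discovery_order_def)
  then have v: "v \<in> discovered \<alpha>"
    using suc.prems(2) discovered_iff by blast
  show ?case
  proof (cases "w \<in> B \<alpha>")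
    case True
    then show ?thesis
      using suc.IH v suc.prems(3) by (auto simp: suc_stage)
  next
    case False
    then have nonempty: "\<not> discovered \<alpha> \<subseteq> B \<alpha>" and "w = q \<alpha>"
      using suc.prems(1) by (auto simp: suc_stage split: if_splits)
    then have "v \<in> B \<alpha> \<or> v = q \<alpha>"
      using q_least(2)[OF nonempty, of v] v suc.prems(3) well_order_on_antisym[OF wo_discovery_order] by blast
    then show ?thesis
      using nonempty by (auto simp: suc_stage)
  qed
next
  case (limit \<alpha>)
  then obtain \<beta> where \<beta>: "\<beta> < \<alpha>" "w \<in> B \<beta>"
    by (auto simp: limit_stage)
  then have "discovery v \<le> \<beta>"
    using limit.prems(3) discovery_le[of w \<beta>] B_subset_discovered[of \<beta>] by (auto simp: discovery_order_def)
  then have "v \<in> discovered \<beta>"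
    using limit.prems(2) discovered_iff by blast
  then show ?case
    using limit.IH[OF \<beta>(1,2)] limit.prems(3) B_mono[OF less_imp_le[OF \<beta>(1)]] by blast
qed

abbreviation \<Gamma> :: "'v ordinal" where "\<Gamma> \<equiv> closure_ordinal E r"

lemma exhausted_iff: "B \<alpha> = B (osuc \<alpha>) \<longleftrightarrow> discovered \<alpha> \<subseteq> B \<alpha>"
  using q_least(1)[of \<alpha>] by (auto simp: suc_stage)

lemma q_visited:
  assumes "\<not> discovered \<alpha> \<subseteq> B \<alpha>" and "\<alpha> < \<beta>"
  shows "q \<alpha> \<in> B \<beta>"
proof -
  have "q \<alpha> \<in> B (osuc \<alpha>)"
    using assms(1) by (simp add: suc_stage)
  then show ?thesis
    using B_mono[of "osuc \<alpha>" \<beta>] assms(2) by (auto simp: osuc_le_iff)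
qed

text \<open>
  As long as the search goes on, each stage visits a new vertex, and there are more ordinals than
  vertices.
\<close>

lemma exhausted_ex: "\<exists>\<alpha>. B \<alpha> = B (osuc \<alpha>)"
proof (rule ccontr)
  assume "\<nexists>\<alpha>. B \<alpha> = B (osuc \<alpha>)"
  then have "\<not> discovered \<alpha> \<subseteq> B \<alpha>" for \<alpha>
    using exhausted_iff by blast
  then have "q \<alpha> \<noteq> q \<beta>" if "\<alpha> < \<beta>" for \<alpha> \<beta>
    using q_visited[of \<alpha> \<beta>] q_least(1)[of \<beta>] that by auto
  then have "inj q"
    by (intro injI) (metis linorder_neqE)
  then show False
    using no_injection_ordinal by blast
qed

lemma discovered_closure: "discovered \<Gamma> = B \<Gamma>"
proof -
  have "B \<Gamma> = B (osuc \<Gamma>)"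
    unfolding closure_ordinal_def using exhausted_ex by (rule LeastI_ex)
  then show ?thesis
    using exhausted_iff B_subset_discovered by blast
qed

lemma unexhausted: "\<alpha> < \<Gamma> \<Longrightarrow> \<not> discovered \<alpha> \<subseteq> B \<alpha>"
  unfolding closure_ordinal_def using not_less_Least exhausted_iff by blast

lemma B_eq: "\<alpha> \<le> \<Gamma> \<Longrightarrow> B \<alpha> = q ` {..<\<alpha>}"
proof (induction \<alpha> rule: ordinal_induct)
  case zero
  then show ?case using ozero_le by (auto simp: zero_stage not_less[symmetric])
next
  case (suc \<alpha>)
  then have "\<alpha> < \<Gamma>" by (simp add: osuc_le_iff)
  moreover have "{..<osuc \<alpha>} = insert \<alpha> {..<\<alpha>}"
    by (auto simp: less_osuc_iff)
  ultimately show ?case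
    using suc unexhausted[of \<alpha>] by (simp add: suc_stage)
next
  case (limit \<alpha>)
  have "q \<beta> \<in> (\<Union>\<beta>\<in>{..<\<alpha>}. B \<beta>)" if "\<beta> < \<alpha>" for \<beta>
    using q_visited[of \<beta> "osuc \<beta>"] unexhausted[of \<beta>] limit_osuc_less[OF limit(2) that]
      that limit.prems less_osuc[of \<beta>] by auto
  moreover have "v \<in> q ` {..<\<alpha>}" if v: "v \<in> B \<beta>" and "\<beta> < \<alpha>" for v \<beta>
  proof -
    have "v \<in> q ` {..<\<beta>}"
      using limit.IH[of \<beta>] v \<open>\<beta> < \<alpha>\<close> limit.prems by auto
    then show ?thesis
      using \<open>\<beta> < \<alpha>\<close> by auto
  qed
  ultimately show ?case
    using limit_stage(1)[OF limit(1,2)] by auto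
qed

lemma neighbor_discovered:
  assumes "\<alpha> < \<Gamma>" shows "E `` {q \<alpha>} \<subseteq> discovered (osuc \<alpha>)"
  using unexhausted[OF assms] by (auto simp: discovered_suc)

lemma B_closure: "B \<Gamma> = V"
proof
  show "B \<Gamma> \<subseteq> V"
    using discovered_subset discovered_closure by metis
  show "V \<subseteq> B \<Gamma>"
  proof
    fix v assume "v \<in> V"
    then have "(root, v) \<in> (Restr E V)\<^sup>*"
      using connected root by (auto simp: induces_connected_def)
    then show "v \<in> B \<Gamma>"
    proof (induction rule: rtrancl_induct)
      case base
      then show ?case
        using discovered_mono[OF ozero_le, of \<Gamma>] by (simp add: discovered_zero discovered_closure)
    next
      case (step u v)
      then obtain \<alpha> where "\<alpha> < \<Gamma>" "u = q \<alpha>"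
        using B_eq by auto
      then show ?case
        using step.hyps(2) neighbor_discovered discovered_mono[of "osuc \<alpha>" \<Gamma>]
        by (auto simp: osuc_le_iff discovered_closure)
    qed
  qed
qed

lemma V_eq: "V = q ` {..<\<Gamma>}"
  using B_closure B_eq by simp

lemma q_le_iff:
  assumes "\<alpha> < \<Gamma>" "\<beta> < \<Gamma>"
  shows "(q \<alpha>, q \<beta>) \<in> discovery_order \<longleftrightarrow> \<alpha> \<le> \<beta>"
proof -
  have in_V: "q \<alpha> \<in> V" if "\<alpha> < \<Gamma>" for \<alpha>
    using that V_eq by auto
  have less: "(q \<beta>, q \<alpha>) \<notin> discovery_order" if "\<alpha> < \<beta>" "\<beta> < \<Gamma>" for \<alpha> \<beta>
    using B_initial_segment[of "q \<alpha>" \<beta> "q \<beta>"] q_visited[of \<alpha> \<beta>] unexhausted that q_least(1)[of \<beta>]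
    by auto
  show ?thesis
    using less[of \<alpha> \<beta>] less[of \<beta> \<alpha>] assms in_V well_order_on_linear[OF wo_discovery_order]
      well_order_on_refl[OF wo_discovery_order] by (metis linorder_not_less order_le_less)
qed

lemma algorithmic_bft_eq: "algorithmic_bft E r = discovery_order"
proof -
  have "(v, w) \<in> algorithmic_bft E r" if vw: "(v, w) \<in> discovery_order" for v w
  proof -
    obtain \<alpha> \<beta> where "v = q \<alpha>" "w = q \<beta>" "\<alpha> < \<Gamma>" "\<beta> < \<Gamma>"
      using well_order_on_in[OF wo_discovery_order vw] V_eq by auto
    then show ?thesis
      using that q_le_iff by (auto simp: algorithmic_bft_def)
  qed
  moreover have "algorithmic_bft E r \<subseteq> discovery_order"
    using q_le_iff by (auto simp: algorithmic_bft_def)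
  ultimately show ?thesis
    by auto
qed

lemma root_first: "wo_rel.minim discovery_order V = root"
proof (rule minim_eqI[OF wo_discovery_order])
  fix v assume v: "v \<in> V"
  have "discovery root = ozero"
    using discovery_le[of root ozero] ozero_le[of "discovery root"] by (simp add: discovered_zero)
  then show "(root, v) \<in> discovery_order"
    using v root ozero_le[of "discovery v"] by (auto simp: discovery_order_def)
qed (use root in auto)

text \<open>
  The parent of \<open>w\<close> is the vertex whose visit discovers \<open>w\<close>. Visiting any neighbor of \<open>w\<close> makes \<open>w\<close>
  discovered, so no neighbor is visited before; and the discovering vertex, being already in the
  queue, was itself discovered earlier.
\<close>

lemma discovery_suc:
  assumes w: "w \<in> V" "w \<noteq> root"
  obtains \<alpha> where "\<alpha> < \<Gamma>" "discovery w = osuc \<alpha>" "least_neighbor E discovery_order w = q \<alpha>"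
    "(w, q \<alpha>) \<in> E" "(q \<alpha>, w) \<in> discovery_order"
proof -
  have wG: "w \<in> discovered \<Gamma>"
    using w by (simp add: discovered_closure B_closure)
  note w_disc = discovered_iff[OF wG]
  have "discovery w \<noteq> ozero"
    using w_disc[of ozero] w by (auto simp: discovered_zero)
  moreover have "\<exists>\<alpha>. discovery w = osuc \<alpha>"
  proof (rule ccontr)
    assume "\<nexists>\<alpha>. discovery w = osuc \<alpha>"
    then obtain \<beta> where "\<beta> < discovery w" "w \<in> discovered \<beta>"
      using limit_stage(3)[OF \<open>discovery w \<noteq> ozero\<close>] w_disc[of "discovery w"] by auto
    then show False
      using w_disc by auto
  qed
  ultimately obtain \<alpha> where \<alpha>: "discovery w = osuc \<alpha>"
    by blast
  have "\<alpha> < \<Gamma>"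
    using w_disc[of \<Gamma>] wG \<alpha> by (simp add: osuc_le_iff)
  have "w \<in> discovered (osuc \<alpha>)" "w \<notin> discovered \<alpha>"
    using w_disc \<alpha> less_osuc[of \<alpha>] by (simp_all add: not_le)
  then have "(q \<alpha>, w) \<in> E"
    by (auto simp: discovered_suc split: if_splits)
  then have wq: "(w, q \<alpha>) \<in> E"
    using undirected by (auto simp: undirected_graph_def dest: symD)
  have "least_neighbor E discovery_order w = q \<alpha>"
    unfolding least_neighbor_def
  proof (rule minim_eqI[OF wo_discovery_order])
    show "E `` {w} \<subseteq> V" using E_subset by auto
    show "q \<alpha> \<in> E `` {w}" using wq by simp
    fix u assume "u \<in> E `` {w}"
    then have uw: "(u, w) \<in> E" "u \<in> V"
      using undirected by (auto simp: undirected_graph_def dest: symD)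
    then obtain \<beta> where \<beta>: "\<beta> < \<Gamma>" "u = q \<beta>"
      using V_eq by auto
    then have "discovery w \<le> osuc \<beta>"
      using neighbor_discovered[of \<beta>] uw w_disc by auto
    then show "(q \<alpha>, u) \<in> discovery_order"
      using \<alpha> \<beta> \<open>\<alpha> < \<Gamma>\<close> q_le_iff by (simp add: osuc_le_iff less_osuc_iff)
  qed
  moreover have "discovery (q \<alpha>) < discovery w"
    using discovery_le[of "q \<alpha>" \<alpha>] q_least(1)[OF unexhausted[OF \<open>\<alpha> < \<Gamma>\<close>]] \<alpha>
    by (simp add: less_osuc_iff)
  then have "(q \<alpha>, w) \<in> discovery_order"
    using wq E_subset by (auto simp: discovery_order_def)
  ultimately show thesis
    using that \<alpha> \<open>\<alpha> < \<Gamma>\<close> wq by blast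
qed

lemma breadth_first_discovery_order: "breadth_first_traversal V E discovery_order"
  unfolding breadth_first_traversal_def root_first
proof (intro conjI ballI impI)
  show "wellordered_traversal V E discovery_order"
    unfolding wellordered_traversal_iff_earlier_neighbor[OF undirected wo_discovery_order] root_first
    by (auto elim: discovery_suc)
  fix v w assume v: "v \<in> V - {root}" and w: "w \<in> V - {root}" and "(v, w) \<in> discovery_order"
  obtain \<alpha> where \<alpha>: "\<alpha> < \<Gamma>" "discovery v = osuc \<alpha>" "least_neighbor E discovery_order v = q \<alpha>"
    using v discovery_suc by blast
  obtain \<beta> where \<beta>: "\<beta> < \<Gamma>" "discovery w = osuc \<beta>" "least_neighbor E discovery_order w = q \<beta>"
    using w discovery_suc by blast
  have "osuc \<alpha> \<le> osuc \<beta>"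
    using \<open>(v, w) \<in> discovery_order\<close> \<alpha> \<beta> by (auto simp: discovery_order_def)
  then show "(least_neighbor E discovery_order v, least_neighbor E discovery_order w) \<in> discovery_order"
    using \<alpha> \<beta> q_le_iff by (simp add: osuc_le_iff less_osuc_iff)
qed

text \<open>
  Siblings have the same discovery, since visits are injective.
\<close>

lemma siblings_sorted:
  assumes "(v, w) \<in> discovery_order" "v \<noteq> root" "w \<noteq> root"
    "least_neighbor E discovery_order v = least_neighbor E discovery_order w"
  shows "(v, w) \<in> r"
proof -
  have in_V: "v \<in> V" "w \<in> V"
    using well_order_on_in[OF wo_discovery_order assms(1)] by auto
  obtain \<alpha> where \<alpha>: "\<alpha> < \<Gamma>" "discovery v = osuc \<alpha>" "least_neighbor E discovery_order v = q \<alpha>"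
    using in_V assms discovery_suc by blast
  obtain \<beta> where \<beta>: "\<beta> < \<Gamma>" "discovery w = osuc \<beta>" "least_neighbor E discovery_order w = q \<beta>"
    using in_V assms discovery_suc by blast
  have "(q \<alpha>, q \<beta>) \<in> discovery_order \<longleftrightarrow> (q \<beta>, q \<alpha>) \<in> discovery_order"
    using assms(4) \<alpha> \<beta> by simp
  then have "\<alpha> = \<beta>"
    using q_le_iff \<alpha> \<beta> by (metis linear order_antisym)
  then show ?thesis
    using assms(1) \<alpha> \<beta> by (simp add: discovery_order_def)
qed

end

theorem proposition5p9:
  fixes V :: "'v set" and E r :: "'v rel"
  assumes "wellordered_connected_graph V E r" and "V \<noteq> {}"
  shows "breadth_first_traversal V E (algorithmic_bft E r) \<and>
    (\<forall>t. breadth_first_traversal V E t \<and> t \<noteq> algorithmic_bft E r \<longrightarrow>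
      lex_less r (algorithmic_bft E r) t)"
proof -
  interpret graph_search V E r
    using assms by (rule graph_search.intro)
  have "lex_less r discovery_order t" if "breadth_first_traversal V E t" "t \<noteq> discovery_order" for t
    by (rule lex_less_if_siblings_sorted[OF undirected wo_r breadth_first_discovery_order _ _ that])
      (auto simp: root_first intro: siblings_sorted)
  then show ?thesis
    using breadth_first_discovery_order by (simp add: algorithmic_bft_eq)
qed

end
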